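(* Let $G$ be an $r$-discrete groupoid and let $X$ be a left $G$-space. Then the action of $G$ on $X$ is strongly locally free.
   Context: A locally compact groupoid is a topological groupoid whose arrow space is locally compact (every point has a compact Hausdorff neighbourhood) and whose space of units $G^{(0)}$ is Hausdorff. It is called $r$-discrete if $G^{(0)}$ is an open subset of $G$. The action of $G$ on a left $G$-space $X$ is strongly locally free if it is strongly locally free at every $\gamma\in G$: there is a neighbourhood $U\subseteq G$ of $\gamma$ such that for all $\eta,\delta\in U$ and $x\in X$ (with $\eta,\delta$ both composable with $x$), $\eta x=\delta x$ implies $\eta=\delta$. *)

theory Defs
  imports "HOL-Analysis.Analysis"
begin

text \<open>
  A groupoid is a small category in which every arrow is invertible.  Objects are identified with
  their identity arrows, so the set of units is a subset of the set of arrows, and \<open>mult g h\<close> is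
  meaningful exactly when \<open>src g = rng h\<close>.
\<close>

locale groupoid =
  fixes arrows units :: "'g set"
    and rng src :: "'g \<Rightarrow> 'g"
    and mult :: "'g \<Rightarrow> 'g \<Rightarrow> 'g"
    and inv :: "'g \<Rightarrow> 'g"
  assumes units_subset: "units \<subseteq> arrows"
    and rng_in_units: "g \<in> arrows \<Longrightarrow> rng g \<in> units"
    and src_in_units: "g \<in> arrows \<Longrightarrow> src g \<in> units"
    and rng_unit: "u \<in> units \<Longrightarrow> rng u = u"
    and src_unit: "u \<in> units \<Longrightarrow> src u = u"
    and mult_closed: "\<lbrakk>g \<in> arrows; h \<in> arrows; src g = rng h\<rbrakk> \<Longrightarrow> mult g h \<in> arrows"
    and rng_mult: "\<lbrakk>g \<in> arrows; h \<in> arrows; src g = rng h\<rbrakk> \<Longrightarrow> rng (mult g h) = rng g"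
    and src_mult: "\<lbrakk>g \<in> arrows; h \<in> arrows; src g = rng h\<rbrakk> \<Longrightarrow> src (mult g h) = src h"
    and mult_assoc: "\<lbrakk>g \<in> arrows; h \<in> arrows; k \<in> arrows; src g = rng h; src h = rng k\<rbrakk>
      \<Longrightarrow> mult (mult g h) k = mult g (mult h k)"
    and left_unit: "g \<in> arrows \<Longrightarrow> mult (rng g) g = g"
    and right_unit: "g \<in> arrows \<Longrightarrow> mult g (src g) = g"
    and inv_closed: "g \<in> arrows \<Longrightarrow> inv g \<in> arrows"
    and rng_inv: "g \<in> arrows \<Longrightarrow> rng (inv g) = src g"
    and src_inv: "g \<in> arrows \<Longrightarrow> src (inv g) = rng g"
    and left_inv: "g \<in> arrows \<Longrightarrow> mult (inv g) g = src g"
    and right_inv: "g \<in> arrows \<Longrightarrow> mult g (inv g) = rng g"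

text \<open>
  The arrow space is the topological space \<open>G\<close>, not assumed to be Hausdorff; the units carry the
  subspace topology and the composable pairs the subspace topology of the product.
\<close>

locale topological_groupoid = groupoid "topspace G" units rng src mult inv
  for G :: "'g topology"
    and units :: "'g set"
    and rng src :: "'g \<Rightarrow> 'g"
    and mult :: "'g \<Rightarrow> 'g \<Rightarrow> 'g"
    and inv :: "'g \<Rightarrow> 'g" +
  assumes continuous_rng: "continuous_map G (subtopology G units) rng"
    and continuous_src: "continuous_map G (subtopology G units) src"
    and continuous_mult:
      "continuous_map (subtopology (prod_topology G G) {(g, h). src g = rng h}) G
         (\<lambda>(g, h). mult g h)"
    and continuous_inv: "continuous_map G G inv"

text \<open>
  The library's \<^const>\<open>locally_compact_space\<close> does not ask the compact neighbourhoods to be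
  Hausdorff, so local compactness is spelled out here.
\<close>

locale locally_compact_groupoid = topological_groupoid +
  assumes compact_Hausdorff_neighbourhood:
      "g \<in> topspace G \<Longrightarrow>
         \<exists>K. compactin G K \<and> Hausdorff_space (subtopology G K) \<and> g \<in> G interior_of K"
    and Hausdorff_units: "Hausdorff_space (subtopology G units)"

locale r_discrete_groupoid = locally_compact_groupoid +
  assumes open_units: "openin G units"

text \<open>
  A left \<open>G\<close>-space is an arbitrary topological space \<open>X\<close> with a continuous momentum map to the
  units, neither open nor surjective in general; \<open>act g x\<close> is meaningful exactly when
  \<open>src g = momentum x\<close>.
\<close>

locale left_groupoid_space = topological_groupoid G units rng src mult inv
  for G :: "'g topology"
    and units :: "'g set"
    and rng src :: "'g \<Rightarrow> 'g"
    and mult :: "'g \<Rightarrow> 'g \<Rightarrow> 'g"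
    and inv :: "'g \<Rightarrow> 'g" +
  fixes X :: "'x topology"
    and momentum :: "'x \<Rightarrow> 'g"
    and act :: "'g \<Rightarrow> 'x \<Rightarrow> 'x"
  assumes continuous_momentum: "continuous_map X (subtopology G units) momentum"
    and continuous_act:
      "continuous_map (subtopology (prod_topology G X) {(g, x). src g = momentum x}) X
         (\<lambda>(g, x). act g x)"
    and momentum_act:
      "\<lbrakk>g \<in> topspace G; x \<in> topspace X; src g = momentum x\<rbrakk> \<Longrightarrow> momentum (act g x) = rng g"
    and unit_act: "x \<in> topspace X \<Longrightarrow> act (momentum x) x = x"
    and mult_act:
      "\<lbrakk>g \<in> topspace G; h \<in> topspace G; x \<in> topspace X; src g = rng h; src h = momentum x\<rbrakk>
         \<Longrightarrow> act (mult g h) x = act g (act h x)"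

definition strongly_locally_free_at ::
  "'g topology \<Rightarrow> ('g \<Rightarrow> 'g) \<Rightarrow> 'x topology \<Rightarrow> ('x \<Rightarrow> 'g) \<Rightarrow> ('g \<Rightarrow> 'x \<Rightarrow> 'x) \<Rightarrow> 'g \<Rightarrow> bool"
  where "strongly_locally_free_at G src X momentum act \<gamma> \<longleftrightarrow>
    (\<exists>U \<subseteq> topspace G. \<gamma> \<in> G interior_of U \<and>
       (\<forall>\<eta>\<in>U. \<forall>\<delta>\<in>U. \<forall>x\<in>topspace X.
          src \<eta> = momentum x \<and> src \<delta> = momentum x \<and> act \<eta> x = act \<delta> x \<longrightarrow> \<eta> = \<delta>))"

definition strongly_locally_free ::
  "'g topology \<Rightarrow> ('g \<Rightarrow> 'g) \<Rightarrow> 'x topology \<Rightarrow> ('x \<Rightarrow> 'g) \<Rightarrow> ('g \<Rightarrow> 'x \<Rightarrow> 'x) \<Rightarrow> bool"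
  where "strongly_locally_free G src X momentum act \<longleftrightarrow>
    (\<forall>\<gamma>\<in>topspace G. strongly_locally_free_at G src X momentum act \<gamma>)"

end

theory Submission
  imports Defs
begin

text \<open>
  Two arrows with a common range can be compared by their quotient \<open>inv \<eta> \<cdot> \<delta>\<close>, which depends
  continuously on the pair and is a unit exactly when \<open>\<eta> = \<delta>\<close>.  On the diagonal it takes the unit
  values \<open>src \<gamma>\<close>; if the units form an open set, it is therefore a unit for all pairs with a common
  range near \<open>(\<gamma>, \<gamma>)\<close>.  So the range map is injective near every arrow
  (\<open>rng_locally_injective\<close>).  This gives strong local freeness for every action, because the
  momentum map recovers the range of an acting arrow from the result: \<open>\<eta> x = \<delta> x\<close> implies
  \<open>rng \<eta> = momentum (\<eta> x) = momentum (\<delta> x) = rng \<delta>\<close>.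
\<close>

context groupoid
begin

lemma eq_of_quotient_in_units:
  assumes a: "a \<in> arrows" and b: "b \<in> arrows" and eq: "rng a = rng b"
    and unit: "mult (inv a) b \<in> units"
  shows "a = b"
proof -
  have comp: "src (inv a) = rng b"
    using a eq src_inv by simp
  have "mult (inv a) b = src a"
    using rng_mult[OF inv_closed[OF a] b comp] rng_unit[OF unit] rng_inv[OF a] by simp
  hence "a = mult a (mult (inv a) b)"
    using a right_unit by simp
  also have "\<dots> = mult (mult a (inv a)) b"
    using mult_assoc[OF a inv_closed[OF a] b] comp a rng_inv by simp
  also have "\<dots> = b"
    using a b eq right_inv left_unit by simp
  finally show ?thesis .
qed

end

context topological_groupoid
begin

lemma continuous_quotient:
  "continuous_map (subtopology (prod_topology G G) {(a, b). rng a = rng b}) G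
     (\<lambda>(a, b). mult (inv a) b)"
proof -
  let ?P = "subtopology (prod_topology G G) {(a, b). rng a = rng b}"
  have fst: "continuous_map ?P G fst" and snd: "continuous_map ?P G snd"
    by (auto intro: continuous_map_from_subtopology continuous_map_fst continuous_map_snd)
  have "continuous_map ?P (prod_topology G G) (\<lambda>p. (inv (fst p), snd p))"
    using continuous_map_compose[OF fst continuous_inv] snd
    by (simp add: continuous_map_pairwise o_def)
  hence "continuous_map ?P (subtopology (prod_topology G G) {(g, h). src g = rng h})
           (\<lambda>p. (inv (fst p), snd p))"
    by (auto simp: continuous_map_in_subtopology src_inv)
  from continuous_map_compose[OF this continuous_mult] show ?thesis
    by (simp add: o_def case_prod_unfold)
qed

text \<open>
  The quotient of the pair \<open>(g, g)\<close> is the unit \<open>src g\<close>, so openness of the units spreads the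
  property of having a unit quotient to a box \<open>V \<times> V\<close> around that pair.
\<close>

lemma rng_locally_injective:
  assumes open_units: "openin G units" and g: "g \<in> topspace G"
  obtains V where "openin G V" "g \<in> V" "inj_on rng V"
proof -
  let ?R = "{(a, b). rng a = rng b}"
  let ?W = "{p \<in> topspace (subtopology (prod_topology G G) ?R).
               (case p of (a, b) \<Rightarrow> mult (inv a) b) \<in> units}"
  have "openin (subtopology (prod_topology G G) ?R) ?W"
    by (rule openin_continuous_map_preimage[OF continuous_quotient open_units])
  then obtain T where T: "openin (prod_topology G G) T" and W: "?W = T \<inter> ?R"
    by (auto simp: openin_subtopology)
  have "(g, g) \<in> ?W"
    using g by (simp add: left_inv src_in_units)
  hence "(g, g) \<in> T"
    unfolding W by simp
  hence "\<exists>A B. openin G A \<and> openin G B \<and> g \<in> A \<and> g \<in> B \<and> A \<times> B \<subseteq> T"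
    using T by (simp add: openin_prod_topology_alt)
  then obtain A B where AB: "openin G A" "openin G B" "g \<in> A" "g \<in> B" "A \<times> B \<subseteq> T"
    by (elim exE conjE)
  have "inj_on rng (A \<inter> B)"
  proof (rule inj_onI)
    fix a b
    assume a: "a \<in> A \<inter> B" and b: "b \<in> A \<inter> B" and eq: "rng a = rng b"
    have "(a, b) \<in> ?W"
      unfolding W using a b eq AB(5) by blast
    hence "a \<in> topspace G" "b \<in> topspace G" and unit: "mult (inv a) b \<in> units"
      by simp_all
    thus "a = b"
      using eq_of_quotient_in_units[OF _ _ eq unit] by blast
  qed
  with AB show ?thesis
    by (intro that[of "A \<inter> B"]) auto
qed

end

lemma (in left_groupoid_space) strongly_locally_free_if_open_units:
  assumes "openin G units"
  shows "strongly_locally_free G src X momentum act"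
  unfolding strongly_locally_free_def
proof
  fix \<gamma>
  assume "\<gamma> \<in> topspace G"
  with assms obtain V where V: "openin G V" "\<gamma> \<in> V" "inj_on rng V"
    by (rule rng_locally_injective)
  have sub: "V \<subseteq> topspace G"
    using V(1) by (rule openin_subset)
  have "\<eta> = \<delta>"
    if in_V: "\<eta> \<in> V" "\<delta> \<in> V" and x: "x \<in> topspace X"
      and comp: "src \<eta> = momentum x" "src \<delta> = momentum x" and eq: "act \<eta> x = act \<delta> x"
    for \<eta> \<delta> x
  proof -
    have "rng \<eta> = rng \<delta>"
      using momentum_act[OF subsetD[OF sub in_V(1)] x comp(1)]
        momentum_act[OF subsetD[OF sub in_V(2)] x comp(2)] eq by simp
    thus ?thesis
      using V(3) in_V by (auto dest: inj_onD)
  qed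
  moreover have "\<gamma> \<in> G interior_of V"
    using V by (simp add: interior_of_openin)
  ultimately show "strongly_locally_free_at G src X momentum act \<gamma>"
    unfolding strongly_locally_free_at_def using sub by (intro exI[of _ V]) simp
qed

theorem proposition1p35:
  fixes G :: "'g topology"
    and units :: "'g set"
    and rng src :: "'g \<Rightarrow> 'g"
    and mult :: "'g \<Rightarrow> 'g \<Rightarrow> 'g"
    and inv :: "'g \<Rightarrow> 'g"
    and X :: "'x topology"
    and momentum :: "'x \<Rightarrow> 'g"
    and act :: "'g \<Rightarrow> 'x \<Rightarrow> 'x"
  assumes "r_discrete_groupoid G units rng src mult inv"
    and "left_groupoid_space G units rng src mult inv X momentum act"
  shows "strongly_locally_free G src X momentum act"
  using assms(2) r_discrete_groupoid.open_units[OF assms(1)]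
  by (rule left_groupoid_space.strongly_locally_free_if_open_units)

end
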